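(* Let $k\ge 1$ and $n\ge 3$ be integers with $n\geq 2k-1$. Then the adjacency spectrum of the graph $BL_n(k-1,k)$ consists of exactly the following eigenvalues with the following multiplicities: \begin{itemize} \item for each $j=0,1,\ldots,k-1$, each of the two numbers $+\sqrt{(k-j)(n-k+1-j)}$ and $-\sqrt{(k-j)(n-k+1-j)}$, with multiplicity $\binom{n}{j}-\binom{n}{j-1}$; \item $0$, with multiplicity $\binom{n}{k}-\binom{n}{k-1}$. \end{itemize}
   Context: Let $[n]=\{1,\ldots,n\}$. For $n\ge 3$, the Boolean lattice $BL_n$ is the graph whose vertices are all subsets of $[n]$, two subsets being adjacent if and only if their symmetric difference has exactly one element. $BL_n(k-1,k)$ is the induced subgraph of $BL_n$ on the set of all $(k-1)$-element subsets and all $k$-element subsets of $[n]$; that is, it is the bipartite graph in which a $(k-1)$-subset $U$ is adjacent to a $k$-subset $W$ if and only if $U\subset W$. The spectrum of a graph is the multiset of eigenvalues of its adjacency matrix. Conventions: $\binom{n}{-1}=0$; an eigenvalue listed with multiplicity $0$ does not occur (this happens for the eigenvalue $0$ when $n=2k-1$). *)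

theory Defs
  imports
    "Graph_Theory.Graph_Theory"
    "Jordan_Normal_Form.Char_Poly"
begin

text \<open>Undirected graphs are symmetric loop-free digraphs: each edge is a pair of opposite arcs.\<close>

definition boolean_lattice :: "nat \<Rightarrow> nat set pair_pre_digraph" where
  "boolean_lattice n =
     \<lparr> pverts = Pow {1..n},
       parcs = {(U, W). U \<subseteq> {1..n} \<and> W \<subseteq> {1..n} \<and> card (sym_diff U W) = 1} \<rparr>"

definition boolean_lattice_levels ::
    "nat \<Rightarrow> nat \<Rightarrow> nat \<Rightarrow> (nat set, nat set \<times> nat set) pre_digraph" where
  "boolean_lattice_levels n a b =
     with_proj (boolean_lattice n) \<restriction> {U. U \<subseteq> {1..n} \<and> (card U = a \<or> card U = b)}"

text \<open>The list \<open>vs\<close> enumerates the vertices, i.e. fixes the order of rows and columns.\<close>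

definition adjacency_matrix :: "('a, 'b) pre_digraph \<Rightarrow> 'a list \<Rightarrow> real mat" where
  "adjacency_matrix G vs =
     mat (length vs) (length vs) (\<lambda>(i, j). if vs ! i \<rightarrow>\<^bsub>G\<^esub> vs ! j then 1 else 0)"

text \<open>Eigenvalues are taken in the complex numbers, with algebraic multiplicity, so that
  none can be lost by definition.\<close>

definition adjacency_spectrum :: "('a, 'b) pre_digraph \<Rightarrow> 'a list \<Rightarrow> complex multiset" where
  "adjacency_spectrum G vs =
     proots (char_poly (map_mat complex_of_real (adjacency_matrix G vs)))"

text \<open>The difference of the binomial coefficients of \<open>n\<close> over \<open>j\<close> and over \<open>j - 1\<close>, where the
  latter is \<open>0\<close> for \<open>j = 0\<close>. The truncated subtraction is exact for \<open>2 * j \<le> n + 1\<close>, see below.\<close>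

definition binomial_diff :: "nat \<Rightarrow> nat \<Rightarrow> nat" where
  "binomial_diff n j = (n choose j) - (if j = 0 then 0 else n choose (j - 1))"

lemma binomial_diff_exact:
  assumes "2 * j \<le> n + 1"
  shows "int (binomial_diff n j) = int (n choose j) - (if j = 0 then 0 else int (n choose (j - 1)))"
proof (cases j)
  case 0
  then show ?thesis by (simp add: binomial_diff_def)
next
  case (Suc i)
  have *: "Suc i * (n choose Suc i) = (n - i) * (n choose i)"
    by (simp only: binomial_absorb_comp binomial_absorption)
  have "Suc i * (n choose i) \<le> Suc i * (n choose Suc i)"
    unfolding * using assms Suc by (intro mult_le_mono1) auto
  then have "n choose i \<le> n choose Suc i" by (simp only: Suc_mult_le_cancel1)
  then show ?thesis using Suc by (simp add: binomial_diff_def)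
qed

lemma card_sym_diff_1_imp:
  assumes "finite U" "finite W" "card U \<le> card W" "card (sym_diff U W) = 1"
  shows "U \<subset> W \<and> card W = Suc (card U)"
proof -
  obtain x where x: "sym_diff U W = {x}" using assms(4) by (auto simp: card_1_singleton_iff)
  have W: "W = sym_diff U {x}" unfolding x[symmetric] by auto
  have "x \<notin> U"
  proof
    assume "x \<in> U"
    then have "W = U - {x}" using W by auto
    then show False using assms(1,3) \<open>x \<in> U\<close> card_Diff1_less[of U x] by simp
  qed
  then have "W = insert x U" using W by auto
  then show ?thesis using assms(1) \<open>x \<notin> U\<close> by auto
qed

lemma pair_graph_boolean_lattice: "pair_graph (boolean_lattice n)"
proof
  show "finite (parcs (boolean_lattice n))"
    by (rule finite_subset[of _ "Pow {1..n} \<times> Pow {1..n}"]) (auto simp: boolean_lattice_def)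
  show "symmetric (with_proj (boolean_lattice n))"
    by (auto simp: symmetric_def boolean_lattice_def sym_def Un_commute)
qed (auto simp: boolean_lattice_def)

lemma verts_boolean_lattice_levels:
  "verts (boolean_lattice_levels n a b) = {U. U \<subseteq> {1..n} \<and> (card U = a \<or> card U = b)}"
  by (simp add: boolean_lattice_levels_def)

lemma adj_boolean_lattice_levels_iff:
  assumes "1 \<le> k" "U \<subseteq> {1..n}" "W \<subseteq> {1..n}" "card U = k - 1" "card W = k"
  shows "U \<rightarrow>\<^bsub>boolean_lattice_levels n (k - 1) k\<^esub> W \<longleftrightarrow> U \<subset> W"
proof -
  have fin: "finite U" "finite W" using assms finite_subset by blast+
  have "card (sym_diff U W) = 1 \<longleftrightarrow> U \<subset> W"
  proof
    assume "card (sym_diff U W) = 1"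
    then show "U \<subset> W" using card_sym_diff_1_imp[OF fin] assms by auto
  next
    assume "U \<subset> W"
    then have "sym_diff U W = W - U" by blast
    then show "card (sym_diff U W) = 1"
      using \<open>U \<subset> W\<close> assms fin by (auto simp: card_Diff_subset)
  qed
  then show ?thesis using assms
    by (auto simp: boolean_lattice_levels_def boolean_lattice_def arcs_ends_conv
        induce_subgraph_def)
qed

lemma not_adj_boolean_lattice_levels_same:
  assumes "U \<subseteq> {1..n}" "W \<subseteq> {1..n}" "card U = card W"
  shows "\<not> U \<rightarrow>\<^bsub>boolean_lattice_levels n a b\<^esub> W"
proof -
  have fin: "finite U" "finite W" using assms finite_subset by blast+
  have "card (sym_diff U W) \<noteq> 1"
    using card_sym_diff_1_imp[OF fin] assms by auto
  then show ?thesis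
    by (auto simp: boolean_lattice_levels_def boolean_lattice_def arcs_ends_conv
        induce_subgraph_def)
qed

end

theory Submission
  imports Defs
begin

text \<open>Let \<open>B\<^sub>k\<close> be the inclusion matrix between levels \<open>k - 1\<close> and \<open>k\<close>. The adjacency matrix is the
  block matrix with off-diagonal blocks \<open>B\<^sub>k\<close> and its transpose, so its characteristic polynomial
  at \<open>x\<close> is, up to a power of \<open>x\<close>, that of \<open>B\<^sub>k B\<^sub>k\<^sup>T\<close> at \<open>x\<^sup>2\<close>. Counting common supersets and common
  subsets gives \<open>B\<^sub>k\<^sub>+\<^sub>1 B\<^sub>k\<^sub>+\<^sub>1\<^sup>T = B\<^sub>k\<^sup>T B\<^sub>k + (n - 2 k) I\<close>, and the characteristic polynomials of
  \<open>B\<^sub>k\<^sup>T B\<^sub>k\<close> and \<open>B\<^sub>k B\<^sub>k\<^sup>T\<close> differ only by a power of \<open>x\<close>. Induction on \<open>k\<close> therefore computes all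
  spectra, without any eigenvectors.\<close>

section \<open>Characteristic polynomials of products and of block matrices\<close>

lemma poly_char_poly_eq_det:
  fixes A :: "'a :: comm_ring_1 mat"
  assumes "A \<in> carrier_mat n n"
  shows "poly (char_poly A) x = det (x \<cdot>\<^sub>m 1\<^sub>m n - A)"
  unfolding char_poly_def
  by (rule poly_det_cong[of _ n]) (use assms in \<open>auto simp: char_poly_matrix_def\<close>)

lemma poly_char_poly_add_scalar:
  fixes A :: "'a :: comm_ring_1 mat"
  assumes A: "A \<in> carrier_mat n n"
  shows "poly (char_poly (A + c \<cdot>\<^sub>m 1\<^sub>m n)) x = poly (char_poly A) (x - c)"
proof -
  have "x \<cdot>\<^sub>m 1\<^sub>m n - (A + c \<cdot>\<^sub>m 1\<^sub>m n) = (x - c) \<cdot>\<^sub>m 1\<^sub>m n - A"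
    by (rule eq_matI) (use A in \<open>auto simp: algebra_simps\<close>)
  with A show ?thesis by (subst (1 2) poly_char_poly_eq_det[of _ n]) auto
qed

text \<open>Sylvester's determinant identity. Multiplying \<open>?M\<close> on the right by
  \<open>?L\<close> clears its lower left block, multiplying it by \<open>?R\<close> clears its
  upper right block, and both products are block triangular. Comparing the two expressions for
  \<open>det ?M\<close> gives the claim. The powers of \<open>x\<close> stay on both sides, so
  nothing is inverted and \<open>x = 0\<close> is covered.\<close>

lemma poly_char_poly_mult_commute:
  fixes B C :: "'a :: idom mat"
  assumes B: "B \<in> carrier_mat p q" and C: "C \<in> carrier_mat q p"
  shows "x ^ q * poly (char_poly (B * C)) x = x ^ p * poly (char_poly (C * B)) x"
proof -
  let ?M = "four_block_mat (x \<cdot>\<^sub>m 1\<^sub>m p) B C (1\<^sub>m q)"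
  let ?L = "four_block_mat (1\<^sub>m p) (0\<^sub>m p q) (- C) (1\<^sub>m q)"
  let ?R = "four_block_mat (1\<^sub>m p) (- B) (0\<^sub>m q p) (x \<cdot>\<^sub>m 1\<^sub>m q)"
  have M: "?M \<in> carrier_mat (p + q) (p + q)" by auto
  have L: "?L \<in> carrier_mat (p + q) (p + q)" and R: "?R \<in> carrier_mat (p + q) (p + q)" by auto
  have BC: "B * C \<in> carrier_mat p p" and CB: "C * B \<in> carrier_mat q q" using B C by auto
  have prodL: "?M * ?L = four_block_mat (x \<cdot>\<^sub>m 1\<^sub>m p - B * C) B (0\<^sub>m q p) (1\<^sub>m q)"
    by (subst mult_four_block_mat[of _ p p _ q _ q _ _ p _ q])
      (use B C in \<open>auto intro!: cong_four_block_mat eq_matI\<close>)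
  have "x \<cdot>\<^sub>m 1\<^sub>m p * - B = x \<cdot>\<^sub>m (- B)"
    using B by (subst mult_smult_assoc_mat[of _ p p]) auto
  moreover have "B * (x \<cdot>\<^sub>m 1\<^sub>m q) = x \<cdot>\<^sub>m B"
    using B by (subst mult_smult_distrib[of _ p q]) auto
  ultimately have prodR: "?M * ?R = four_block_mat (x \<cdot>\<^sub>m 1\<^sub>m p) (0\<^sub>m p q) C (x \<cdot>\<^sub>m 1\<^sub>m q - C * B)"
    by (subst mult_four_block_mat[of _ p p _ q _ q _ _ p _ q])
      (use B C in \<open>auto intro!: cong_four_block_mat eq_matI\<close>)
  have "det (?M * ?L) = det ?M"
    by (subst det_mult[OF M L], subst det_four_block_mat_upper_right_zero[of _ p _ q]) (use C in auto)
  then have 1: "det ?M = poly (char_poly (B * C)) x"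
    unfolding prodL poly_char_poly_eq_det[OF BC]
    by (subst (asm) det_four_block_mat_lower_left_zero[of _ p _ q]) (use B C in auto)
  have "det (?M * ?R) = det ?M * x ^ q"
    by (subst det_mult[OF M R], subst det_four_block_mat_lower_left_zero[of _ p _ q]) (use B in auto)
  then have "det ?M * x ^ q = x ^ p * poly (char_poly (C * B)) x"
    unfolding prodR poly_char_poly_eq_det[OF CB]
    by (subst (asm) det_four_block_mat_upper_right_zero[of _ p _ q]) (use B C in auto)
  with 1 show ?thesis by (simp add: mult.commute)
qed

text \<open>Again block elimination: the right factor \<open>?L\<close> turns \<open>x I - A\<close>
  into a block upper triangular matrix with diagonal blocks \<open>x^2 I - B C\<close> and
  \<open>x I\<close>, and \<open>det ?L\<close> is \<open>x ^ p\<close>.\<close>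

lemma poly_char_poly_bipartite:
  fixes B C :: "'a :: idom mat"
  assumes B: "B \<in> carrier_mat p q" and C: "C \<in> carrier_mat q p"
  shows "x ^ p * poly (char_poly (four_block_mat (0\<^sub>m p p) B C (0\<^sub>m q q))) x =
    x ^ q * poly (char_poly (B * C)) (x ^ 2)"
proof -
  let ?A = "four_block_mat (0\<^sub>m p p) B C (0\<^sub>m q q)"
  let ?M = "four_block_mat (x \<cdot>\<^sub>m 1\<^sub>m p) (- B) (- C) (x \<cdot>\<^sub>m 1\<^sub>m q)"
  let ?L = "four_block_mat (x \<cdot>\<^sub>m 1\<^sub>m p) (0\<^sub>m p q) C (1\<^sub>m q)"
  have M: "?M \<in> carrier_mat (p + q) (p + q)" and L: "?L \<in> carrier_mat (p + q) (p + q)" by auto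
  have A: "?A \<in> carrier_mat (p + q) (p + q)" by auto
  have BC: "B * C \<in> carrier_mat p p" using B C by auto
  have xA: "x \<cdot>\<^sub>m 1\<^sub>m (p + q) - ?A = ?M"
    by (rule eq_matI) (use B C in auto)
  have prodL: "?M * ?L = four_block_mat (x ^ 2 \<cdot>\<^sub>m 1\<^sub>m p - B * C) (- B) (0\<^sub>m q p) (x \<cdot>\<^sub>m 1\<^sub>m q)"
    by (subst mult_four_block_mat[of _ p p _ q _ q _ _ p _ q])
      (use B C in \<open>auto intro!: cong_four_block_mat eq_matI simp: power2_eq_square\<close>)
  have "det (?M * ?L) = det ?M * x ^ p"
    by (subst det_mult[OF M L], subst det_four_block_mat_upper_right_zero[of _ p _ q]) (use C in auto)
  then have "det ?M * x ^ p = poly (char_poly (B * C)) (x ^ 2) * x ^ q"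
    unfolding prodL poly_char_poly_eq_det[OF BC]
    by (subst (asm) det_four_block_mat_lower_left_zero[of _ p _ q]) (use B C in auto)
  then show ?thesis unfolding poly_char_poly_eq_det[OF A] xA by (simp add: mult.commute)
qed

section \<open>Matrices with labelled rows and columns\<close>

definition idx_mat :: "('a \<Rightarrow> 'b \<Rightarrow> 'c) \<Rightarrow> 'a list \<Rightarrow> 'b list \<Rightarrow> 'c mat" where
  "idx_mat f xs ys = mat (length xs) (length ys) (\<lambda>(i, j). f (xs ! i) (ys ! j))"

lemma idx_mat_carrier [simp]: "idx_mat f xs ys \<in> carrier_mat (length xs) (length ys)"
  by (simp add: idx_mat_def)

lemma idx_mat_cong:
  assumes "\<And>x y. x \<in> set xs \<Longrightarrow> y \<in> set ys \<Longrightarrow> f x y = g x y"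
  shows "idx_mat f xs ys = idx_mat g xs ys"
  by (rule eq_matI) (auto simp: idx_mat_def assms)

text \<open>Distinctness of \<open>ys\<close> makes positions and labels correspond bijectively, so
  a matrix product becomes a sum over a set. For inclusion matrices such a sum counts sets.\<close>

lemma idx_mat_mult:
  fixes f :: "'a \<Rightarrow> 'b \<Rightarrow> 'c :: semiring_0"
  assumes "distinct ys"
  shows "idx_mat f xs ys * idx_mat g ys zs = idx_mat (\<lambda>x z. \<Sum>y\<in>set ys. f x y * g y z) xs zs"
proof (rule eq_matI)
  fix i j
  assume "i < dim_row (idx_mat (\<lambda>x z. \<Sum>y\<in>set ys. f x y * g y z) xs zs)"
    and "j < dim_col (idx_mat (\<lambda>x z. \<Sum>y\<in>set ys. f x y * g y z) xs zs)"
  then have ij: "i < length xs" "j < length zs" by (auto simp: idx_mat_def)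
  have "bij_betw ((!) ys) {0..<length ys} (set ys)"
    using assms by (auto intro!: bij_betw_nth)
  then have "(\<Sum>l = 0..<length ys. f (xs ! i) (ys ! l) * g (ys ! l) (zs ! j)) =
      (\<Sum>y\<in>set ys. f (xs ! i) y * g y (zs ! j))"
    by (rule sum.reindex_bij_betw)
  with ij show "(idx_mat f xs ys * idx_mat g ys zs) $$ (i, j) =
      idx_mat (\<lambda>x z. \<Sum>y\<in>set ys. f x y * g y z) xs zs $$ (i, j)"
    by (simp add: idx_mat_def scalar_prod_def)
qed (auto simp: idx_mat_def)

lemma idx_mat_one:
  assumes "distinct xs"
  shows "idx_mat (\<lambda>x y. of_bool (x = y)) xs xs = 1\<^sub>m (length xs)"
  by (rule eq_matI) (use assms in \<open>auto simp: idx_mat_def nth_eq_iff_index_eq\<close>)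

lemma idx_mat_append:
  "idx_mat f (xs @ ys) (us @ vs) =
    four_block_mat (idx_mat f xs us) (idx_mat f xs vs) (idx_mat f ys us) (idx_mat f ys vs)"
  by (rule eq_matI) (auto simp: idx_mat_def nth_append)

text \<open>The matrices are similar via the permutation matrix \<open>idx_mat ?d xs ys\<close>.
  This allows an arbitrary vertex enumeration to be replaced by one that lists the two levels
  consecutively.\<close>

lemma char_poly_idx_mat_permute:
  fixes f :: "'a \<Rightarrow> 'a \<Rightarrow> 'c :: comm_ring_1"
  assumes xs: "distinct xs" and ys: "distinct ys" and eq: "set xs = set ys"
  shows "char_poly (idx_mat f xs xs) = char_poly (idx_mat f ys ys)"
proof (rule char_poly_similar, rule similar_matI)
  let ?d = "\<lambda>x y. of_bool (x = y) :: 'c"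
  have len: "length xs = length ys" using assms distinct_card by metis
  show "{idx_mat f xs xs, idx_mat f ys ys, idx_mat ?d xs ys, idx_mat ?d ys xs}
      \<subseteq> carrier_mat (length xs) (length xs)"
    using len by (auto simp: idx_mat_def)
  show "idx_mat ?d xs ys * idx_mat ?d ys xs = 1\<^sub>m (length xs)"
    unfolding idx_mat_mult[OF ys] idx_mat_one[OF xs, symmetric]
    by (rule idx_mat_cong) (auto simp: eq)
  show "idx_mat ?d ys xs * idx_mat ?d xs ys = 1\<^sub>m (length xs)"
    unfolding idx_mat_mult[OF xs] len idx_mat_one[OF ys, symmetric]
    by (rule idx_mat_cong) (auto simp: eq)
  show "idx_mat f xs xs = idx_mat ?d xs ys * idx_mat f ys ys * idx_mat ?d ys xs"
    unfolding idx_mat_mult[OF ys] by (rule idx_mat_cong) (auto simp: eq)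
qed

section \<open>Levels of the Boolean lattice and counting in them\<close>

definition level :: "nat \<Rightarrow> nat \<Rightarrow> nat set set" where
  "level n m = {U. U \<subseteq> {1..n} \<and> card U = m}"

lemma adj_boolean_lattice_levels_sym:
  "U \<rightarrow>\<^bsub>boolean_lattice_levels n a b\<^esub> W \<longleftrightarrow> W \<rightarrow>\<^bsub>boolean_lattice_levels n a b\<^esub> U"
  by (auto simp: boolean_lattice_levels_def boolean_lattice_def arcs_ends_conv
      induce_subgraph_def Un_commute)

lemma finite_level [simp]: "finite (level n m)"
  unfolding level_def by (rule finite_subset[of _ "Pow {1..n}"]) auto

lemma card_level: "card (level n m) = n choose m"
  unfolding level_def using n_subsets[of "{1..n}" m] by simp

lemma card_level_above:
  assumes "U \<in> level n m"
  shows "card {W \<in> level n (Suc m). U \<subseteq> W} = n - m"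
proof -
  have U: "U \<subseteq> {1..n}" "card U = m" and fin: "finite U"
    using assms finite_subset by (auto simp: level_def)
  have "{W \<in> level n (Suc m). U \<subseteq> W} = (\<lambda>x. insert x U) ` ({1..n} - U)"
  proof (intro equalityI subsetI)
    fix W assume "W \<in> {W \<in> level n (Suc m). U \<subseteq> W}"
    then have W: "W \<subseteq> {1..n}" "card W = Suc m" "U \<subseteq> W" by (auto simp: level_def)
    then have "card (W - U) = 1" using U fin by (simp add: card_Diff_subset)
    then obtain x where "W - U = {x}" by (auto simp: card_1_singleton_iff)
    with W show "W \<in> (\<lambda>x. insert x U) ` ({1..n} - U)"
      by (intro image_eqI[of _ _ x]) auto
  qed (use U fin in \<open>auto simp: level_def\<close>)
  moreover have "inj_on (\<lambda>x. insert x U) ({1..n} - U)" by (auto simp: inj_on_def)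
  ultimately show ?thesis using U fin by (simp add: card_image card_Diff_subset)
qed

lemma card_level_below:
  assumes "U \<in> level n (Suc m)"
  shows "card {V \<in> level n m. V \<subseteq> U} = Suc m"
proof -
  have U: "U \<subseteq> {1..n}" "card U = Suc m" and fin: "finite U"
    using assms finite_subset by (auto simp: level_def)
  have "{V \<in> level n m. V \<subseteq> U} = {V. V \<subseteq> U \<and> card V = m}"
    using U by (auto simp: level_def)
  then show ?thesis using n_subsets[OF fin, of m] U by simp
qed

text \<open>The only candidates are the union above and the intersection below. Their sizes add up
  to \<open>2 * Suc m\<close>, so the union has size \<open>m + 2\<close> exactly when the
  intersection has size \<open>m\<close>: both counts are 1 or both are 0.\<close>

lemma card_common_above_eq_below:
  assumes U: "U \<in> level n (Suc m)" and U': "U' \<in> level n (Suc m)" and ne: "U \<noteq> U'"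
  shows "card {W \<in> level n (Suc (Suc m)). U \<subseteq> W \<and> U' \<subseteq> W} =
    card {V \<in> level n m. V \<subseteq> U \<and> V \<subseteq> U'}"
proof -
  have fin: "finite U" "finite U'" and sub: "U \<subseteq> {1..n}" "U' \<subseteq> {1..n}"
    and card: "card U = Suc m" "card U' = Suc m"
    using U U' finite_subset by (auto simp: level_def)
  have sum: "card (U \<union> U') + card (U \<inter> U') = Suc m + Suc m"
    using card_Un_Int[OF fin] card by simp
  have "\<not> U' \<subseteq> U" using card_subset_eq[of U U'] fin card ne by auto
  then have "U \<subset> U \<union> U'" by blast
  then have gt: "card (U \<union> U') > Suc m" using psubset_card_mono[of "U \<union> U'" U] fin card by simp
  show ?thesis
  proof (cases "card (U \<union> U') = Suc (Suc m)")
    case True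
    have "{W \<in> level n (Suc (Suc m)). U \<subseteq> W \<and> U' \<subseteq> W} = {U \<union> U'}"
    proof (intro equalityI subsetI)
      fix W assume "W \<in> {W \<in> level n (Suc (Suc m)). U \<subseteq> W \<and> U' \<subseteq> W}"
      then have "finite W" "U \<union> U' \<subseteq> W" "card W = Suc (Suc m)"
        using finite_subset by (auto simp: level_def)
      with True show "W \<in> {U \<union> U'}" using card_subset_eq[of W "U \<union> U'"] by simp
    qed (use True sub in \<open>auto simp: level_def\<close>)
    moreover have "{V \<in> level n m. V \<subseteq> U \<and> V \<subseteq> U'} = {U \<inter> U'}"
    proof (intro equalityI subsetI)
      fix V assume "V \<in> {V \<in> level n m. V \<subseteq> U \<and> V \<subseteq> U'}"
      then have "V \<subseteq> U \<inter> U'" "card V = card (U \<inter> U')" using True sum by (auto simp: level_def)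
      then show "V \<in> {U \<inter> U'}" using card_subset_eq[of "U \<inter> U'" V] fin by simp
    qed (use True sum sub in \<open>auto simp: level_def\<close>)
    ultimately show ?thesis by simp
  next
    case False
    \<comment> \<open>Here the union has at least \<open>m + 3\<close> elements, too many for
      \<open>W\<close>; the intersection then has fewer than \<open>m\<close>, too few for any
      \<open>V\<close>.\<close>
    have "card W \<noteq> Suc (Suc m)" if "W \<subseteq> {1..n}" "U \<subseteq> W" "U' \<subseteq> W" for W
      using card_mono[of W "U \<union> U'"] that False gt finite_subset[of W "{1..n}"] by auto
    then have above: "{W \<in> level n (Suc (Suc m)). U \<subseteq> W \<and> U' \<subseteq> W} = {}"
      by (auto simp: level_def)
    have "card V \<noteq> m" if "V \<subseteq> U" "V \<subseteq> U'" for V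
      using card_mono[of "U \<inter> U'" V] that False gt sum fin by auto
    then have "{V \<in> level n m. V \<subseteq> U \<and> V \<subseteq> U'} = {}" by (auto simp: level_def)
    then show ?thesis unfolding above by simp
  qed
qed

section \<open>The recursion from one level to the next\<close>

definition incl :: "nat set \<Rightarrow> nat set \<Rightarrow> complex" where
  "incl U W = of_bool (U \<subseteq> W)"

text \<open>Off the diagonal both counts agree by \<open>card_common_above_eq_below\<close>. On the
  diagonal there are \<open>n - Suc m\<close> supersets and \<open>Suc m\<close> subsets, which
  differ by the scalar.\<close>

lemma up_down_eq_down_up_plus_scalar:
  assumes "U \<in> level n (Suc m)" and "U' \<in> level n (Suc m)"
  shows "(\<Sum>W\<in>level n (Suc (Suc m)). incl U W * incl U' W) =
    (\<Sum>V\<in>level n m. incl V U * incl V U') + (of_nat n - 2 * of_nat (Suc m)) * of_bool (U = U')"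
proof -
  have "card U \<le> card {1..n}" using assms by (intro card_mono) (auto simp: level_def)
  then have "Suc m \<le> n" using assms by (auto simp: level_def)
  have above: "(\<Sum>W\<in>level n (Suc (Suc m)). incl U W * incl U' W) =
      of_nat (card {W \<in> level n (Suc (Suc m)). U \<subseteq> W \<and> U' \<subseteq> W})"
    by (simp add: incl_def flip: of_bool_conj) (simp add: sum.If_cases of_bool_def Int_def)
  have below: "(\<Sum>V\<in>level n m. incl V U * incl V U') =
      of_nat (card {V \<in> level n m. V \<subseteq> U \<and> V \<subseteq> U'})"
    by (simp add: incl_def flip: of_bool_conj) (simp add: sum.If_cases of_bool_def Int_def)
  show ?thesis
  proof (cases "U = U'")
    case True
    with assms \<open>Suc m \<le> n\<close> show ?thesis
      unfolding above below by (simp add: card_level_above card_level_below of_nat_diff)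
  next
    case False
    with assms card_common_above_eq_below show ?thesis unfolding above below by simp
  qed
qed

lemma binomial_le_Suc:
  assumes "2 * Suc m \<le> n + 1"
  shows "n choose m \<le> n choose Suc m"
  using binomial_diff_exact[of "Suc m" n] assms by simp

text \<open>Passing from \<open>m\<close> to \<open>Suc m\<close> adds
  \<open>binomial_diff n (Suc m)\<close> zero roots and then shifts every root by \<open>?c\<close>.
  The point \<open>y\<close> is kept arbitrary because the shift evaluates the induction hypothesis
  at \<open>y - ?c\<close>.\<close>

lemma poly_char_poly_up_down:
  assumes "2 * m \<le> n + 1" and "distinct us" "set us = level n m"
    and "distinct ws" "set ws = level n (Suc m)"
  shows "poly (char_poly (idx_mat incl us ws * idx_mat (\<lambda>W U. incl U W) ws us)) y =
    (\<Prod>j\<le>m. (y - (of_nat (Suc m) - of_nat j) * (of_nat n - of_nat m - of_nat j)) ^ binomial_diff n j)"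
  using assms
proof (induction m arbitrary: us ws y)
  case 0
  \<comment> \<open>Level 0 contains only the empty set, so the product is the 1 by 1 matrix whose
    entry is the number \<open>n\<close> of singletons.\<close>
  have L0: "level n 0 = {{}}" by (auto simp: level_def dest: finite_subset)
  have "length us = 1" using 0 distinct_card card_level by fastforce
  with 0 L0 have us: "us = [{}]" by (auto simp: length_Suc_conv)
  have "incl {} W = 1" for W by (simp add: incl_def)
  then have "idx_mat incl us ws * idx_mat (\<lambda>W U. incl U W) ws us = of_nat n \<cdot>\<^sub>m 1\<^sub>m 1"
    unfolding idx_mat_mult[OF 0(4)] 0
    by (intro eq_matI) (auto simp: idx_mat_def us card_level)
  then show ?case
    using det_single[of "y \<cdot>\<^sub>m 1\<^sub>m 1 - of_nat n \<cdot>\<^sub>m 1\<^sub>m 1"]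
    by (simp add: poly_char_poly_eq_det[of _ 1] binomial_diff_def minus_carrier_mat)
next
  case (Suc m)
  obtain vs where vs: "distinct vs" "set vs = level n m"
    using finite_distinct_list[of "level n m"] by auto
  let ?c = "of_nat n - 2 * of_nat (Suc m) :: complex"
  let ?B = "idx_mat incl vs us" and ?C = "idx_mat (\<lambda>W U. incl U W) us vs"
  have lens: "length vs = n choose m" "length us = n choose Suc m"
    using vs Suc.prems distinct_card card_level by metis+
  have B: "?B \<in> carrier_mat (n choose m) (n choose Suc m)"
    and C: "?C \<in> carrier_mat (n choose Suc m) (n choose m)" by (simp_all flip: lens)
  have le: "n choose m \<le> n choose Suc m" using binomial_le_Suc Suc.prems by blast
  have commute: "poly (char_poly (?C * ?B)) z = z ^ binomial_diff n (Suc m) * poly (char_poly (?B * ?C)) z" for z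
  proof -
    \<comment> \<open>The common power of the variable is cancelled between polynomials; dividing
      values would fail at \<open>z = 0\<close>.\<close>
    let ?X = "[:0, 1:] :: complex poly"
    have "?X ^ (n choose m) * char_poly (?C * ?B) =
        ?X ^ (n choose m) * (?X ^ binomial_diff n (Suc m) * char_poly (?B * ?C))"
      using poly_char_poly_mult_commute[OF B C] le
      by (intro poly_ext) (simp add: binomial_diff_def flip: power_add mult.assoc)
    then have "char_poly (?C * ?B) = ?X ^ binomial_diff n (Suc m) * char_poly (?B * ?C)" by simp
    then show ?thesis by simp
  qed
  have "idx_mat incl us ws * idx_mat (\<lambda>W U. incl U W) ws us = ?C * ?B + ?c \<cdot>\<^sub>m 1\<^sub>m (n choose Suc m)"
  proof -
    have "idx_mat incl us ws * idx_mat (\<lambda>W U. incl U W) ws us =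
      idx_mat (\<lambda>U U'. (\<Sum>V\<in>level n m. incl V U * incl V U') + ?c * of_bool (U = U')) us us"
      unfolding idx_mat_mult[OF Suc.prems(4)]
      by (rule idx_mat_cong) (use Suc.prems up_down_eq_down_up_plus_scalar in auto)
    also have "\<dots> = ?C * ?B + ?c \<cdot>\<^sub>m idx_mat (\<lambda>U U'. of_bool (U = U')) us us"
      unfolding idx_mat_mult[OF vs(1)] vs(2) by (rule eq_matI) (auto simp: idx_mat_def)
    finally show ?thesis unfolding idx_mat_one[OF Suc.prems(2)] lens .
  qed
  then have "poly (char_poly (idx_mat incl us ws * idx_mat (\<lambda>W U. incl U W) ws us)) y =
      poly (char_poly (?C * ?B)) (y - ?c)"
    using poly_char_poly_add_scalar[of "?C * ?B" "n choose Suc m"] B C by simp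
  also have "\<dots> = (y - ?c) ^ binomial_diff n (Suc m) *
      (\<Prod>j\<le>m. (y - ?c - (of_nat (Suc m) - of_nat j) * (of_nat n - of_nat m - of_nat j)) ^ binomial_diff n j)"
    unfolding commute using Suc.IH[OF _ vs Suc.prems(2,3)] Suc.prems(1) by simp
  \<comment> \<open>With \<open>a = m + 1 - j\<close> and \<open>b = n - m - j\<close>, the shift is
    \<open>?c = b - a - 1\<close>, hence \<open>a * b + ?c = (a + 1) * (b - 1)\<close>. The new
    factor, \<open>j = Suc m\<close>, has root \<open>?c\<close> itself.\<close>
  also have "\<dots> = (\<Prod>j\<le>Suc m. (y - (of_nat (Suc (Suc m)) - of_nat j) *
      (of_nat n - of_nat (Suc m) - of_nat j)) ^ binomial_diff n j)"
    by (simp add: algebra_simps)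
  finally show ?case .
qed

section \<open>The spectrum of two consecutive levels\<close>

theorem theorem3p1:
  fixes n k :: nat and vs :: "nat set list"
  assumes "k \<ge> 1" and "n \<ge> 3" and "n \<ge> 2 * k - 1"
    and "distinct vs" and "set vs = verts (boolean_lattice_levels n (k - 1) k)"
  shows "adjacency_spectrum (boolean_lattice_levels n (k - 1) k) vs =
      (\<Sum>j\<in>{0..k - 1}.
         replicate_mset (binomial_diff n j)
           (complex_of_real (sqrt ((real k - real j) * (real n - real k + 1 - real j)))) +
         replicate_mset (binomial_diff n j)
           (complex_of_real (- sqrt ((real k - real j) * (real n - real k + 1 - real j)))))
      + replicate_mset (binomial_diff n k) 0"
proof -
  obtain m where k: "k = Suc m" using assms(1) by (cases k) auto
  let ?G = "boolean_lattice_levels n (k - 1) k"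
  let ?adj = "\<lambda>U W. of_bool (U \<rightarrow>\<^bsub>?G\<^esub> W) :: complex"
  define s where "s j = sqrt ((real k - real j) * (real n - real k + 1 - real j))" for j
  obtain us where us: "distinct us" "set us = level n m"
    using finite_distinct_list[of "level n m"] by auto
  obtain ws where ws: "distinct ws" "set ws = level n k"
    using finite_distinct_list[of "level n k"] by auto
  let ?p = "n choose m" and ?q = "n choose k"
  let ?B = "idx_mat incl us ws" and ?C = "idx_mat (\<lambda>W U. incl U W) ws us"
  have lens: "length us = ?p" "length ws = ?q"
    using us ws distinct_card card_level by metis+
  have B: "?B \<in> carrier_mat ?p ?q" and C: "?C \<in> carrier_mat ?q ?p" by (simp_all flip: lens)
  \<comment> \<open>The hypothesis \<open>n \<ge> 2 * k - 1\<close> enters here; it makes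
    \<open>binomial_diff n k\<close> the true difference \<open>?q - ?p\<close>.\<close>
  have le: "?p \<le> ?q" using binomial_le_Suc[of m n] assms(3) k by simp
  have adj: "U \<rightarrow>\<^bsub>?G\<^esub> W \<longleftrightarrow> U \<subseteq> W" "W \<rightarrow>\<^bsub>?G\<^esub> U \<longleftrightarrow> U \<subseteq> W" 
    if "U \<in> level n m" "W \<in> level n k" for U W
  proof -
    have "card U \<noteq> card W" using that k by (simp add: level_def)
    then show "U \<rightarrow>\<^bsub>?G\<^esub> W \<longleftrightarrow> U \<subseteq> W"
      using adj_boolean_lattice_levels_iff[of k U n W] that k by (auto simp: level_def)
    then show "W \<rightarrow>\<^bsub>?G\<^esub> U \<longleftrightarrow> U \<subseteq> W"
      by (simp add: adj_boolean_lattice_levels_sym[of W])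
  qed
  have nadj: "\<not> U \<rightarrow>\<^bsub>?G\<^esub> W" if "U \<in> level n l" "W \<in> level n l" for U W l
    using that by (intro not_adj_boolean_lattice_levels_same) (auto simp: level_def)
  have dist: "distinct (us @ ws)" and set: "set vs = set (us @ ws)"
    using us ws assms(5) k by (auto simp: verts_boolean_lattice_levels level_def)
  have "map_mat complex_of_real (adjacency_matrix ?G vs) = idx_mat ?adj vs vs"
    by (rule eq_matI) (auto simp: adjacency_matrix_def idx_mat_def)
  then have "char_poly (map_mat complex_of_real (adjacency_matrix ?G vs)) =
      char_poly (idx_mat ?adj (us @ ws) (us @ ws))"
    using char_poly_idx_mat_permute[OF assms(4) dist set] by simp
  also have "idx_mat ?adj (us @ ws) (us @ ws) = four_block_mat (0\<^sub>m ?p ?p) ?B ?C (0\<^sub>m ?q ?q)"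
    unfolding idx_mat_append
  proof (rule cong_four_block_mat)
    have zero: "idx_mat ?adj xs xs = 0\<^sub>m (length xs) (length xs)" if "set xs = level n l" for xs l
      by (rule eq_matI) (use nadj that in \<open>auto simp: idx_mat_def dest!: nth_mem\<close>)
    show "idx_mat ?adj us us = 0\<^sub>m ?p ?p" "idx_mat ?adj ws ws = 0\<^sub>m ?q ?q"
      using zero[OF us(2)] zero[OF ws(2)] unfolding lens .
    show "idx_mat ?adj us ws = ?B" "idx_mat ?adj ws us = ?C"
      by (rule idx_mat_cong; use adj us ws in \<open>auto simp: incl_def\<close>)+
  qed
  \<comment> \<open>The block lemma evaluates the product polynomial at the square of the variable,
    so each root \<open>s j ^ 2\<close> splits into the pair of linear factors with roots
    \<open>s j\<close> and \<open>- s j\<close>.\<close>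
  also have "char_poly \<dots> = [:0, 1:] ^ binomial_diff n k *
      (\<Prod>j\<le>m. ([:- of_real (s j), 1:] * [:of_real (s j), 1:]) ^ binomial_diff n j)" (is "?P = ?Q")
  proof -
    have s2: "complex_of_real (s j) * complex_of_real (s j) =
        (of_nat (Suc m) - of_nat j) * (of_nat n - of_nat m - of_nat j)" if "j \<le> m" for j
    proof -
      \<comment> \<open>Both factors are nonnegative, since \<open>j < k\<close> and
        \<open>n - k + 1 - j \<ge> k - j\<close>; so the real square root squares back to the
        product.\<close>
      have "(real k - real j) * (real n - real k + 1 - real j) \<ge> 0"
        using that assms(3) k by (intro mult_nonneg_nonneg) auto
      then have "s j * s j = (real (Suc m) - real j) * (real n - real m - real j)"
        unfolding s_def by (simp add: k)
      then have "complex_of_real (s j * s j) =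
          complex_of_real ((real (Suc m) - real j) * (real n - real m - real j))" by simp
      then show ?thesis by simp
    qed
    \<comment> \<open>The factor of degree \<open>?p\<close> comes from
      \<open>poly_char_poly_bipartite\<close>. On the right it combines with
      \<open>binomial_diff n k\<close> to the exponent \<open>?q\<close>, and it is cancelled
      afterwards as a nonzero polynomial.\<close>
    have "[:0, 1:] ^ ?p * ?P = [:0, 1:] ^ ?p * ?Q"
    proof (rule poly_ext)
      fix x :: complex
      have "(\<Prod>j\<le>m. (x\<^sup>2 - (of_nat (Suc m) - of_nat j) * (of_nat n - of_nat m - of_nat j)) ^ binomial_diff n j)
        = (\<Prod>j\<le>m. (x * x - of_real (s j) * of_real (s j)) ^ binomial_diff n j)"
        by (rule prod.cong[OF refl], subst s2[symmetric]) (simp_all add: algebra_simps power2_eq_square)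
      then show "poly ([:0, 1:] ^ ?p * ?P) x = poly ([:0, 1:] ^ ?p * ?Q) x"
        using poly_char_poly_bipartite[OF B C, of x] assms(3) k le
          poly_char_poly_up_down[of m n us ws "x\<^sup>2", OF _ us ws(1)] ws(2)
        by (simp add: poly_prod binomial_diff_def add.commute flip: power_add mult.assoc)
    qed
    then show ?thesis by simp
  qed
  finally have spec: "adjacency_spectrum ?G vs = proots ?Q" unfolding adjacency_spectrum_def by simp
  \<comment> \<open>Each quadratic contributes both signs, with no need for \<open>s j\<close> and
    \<open>- s j\<close> to be distinct, because multisets of roots add under
    multiplication.\<close>
  have "proots ([:- of_real (s j), 1:] * [:of_real (s j), 1:]) =
      {#complex_of_real (s j), complex_of_real (- s j)#}" for j
    by (subst proots_mult) (auto simp del: mult_pCons_left mult_pCons_right)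
  then have "proots ?Q = replicate_mset (binomial_diff n k) 0 +
     (\<Sum>j\<le>m. replicate_mset (binomial_diff n j) (complex_of_real (s j)) +
       replicate_mset (binomial_diff n j) (complex_of_real (- s j)))"
    by (subst proots_mult)
      (auto simp: proots_prod proots_power simp del: mult_pCons_left mult_pCons_right)
  then show ?thesis
    unfolding spec by (simp add: s_def k atMost_atLeast0 add.commute)
qed

end
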